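(* Let $U_1,\dots,U_m\subset\mathbb{R}^n$ be closed convex sets with $S:=\bigcap_{i=1}^m U_i\neq\varnothing$. Let $T:\mathbb{R}^n\to\mathbb{R}^n$ satisfy, for some constant $c_0\in(0,1]$, $$\|Ty-s\|^2\le\|y-s\|^2-c_0\,\delta(y)^2\qquad\text{for all } s\in S,\ y\in\mathbb{R}^n .$$ Let $\alpha_0\in(0,1]$ and let $(\alpha_k)_{k\ge1}$ satisfy: (i) $\alpha_k\in(0,1]$ for all $k\ge 1$; (ii) $\alpha_k\to0$; (iii) $\limsup_{k\to\infty}\left(\frac1{\alpha_{k+1}}-\frac1{\alpha_k}\right)<2$; (iv) $\lim_{k\to\infty}\frac{\alpha_k}{\alpha_{k+1}}=1$. Let $x\in\mathbb{R}^n$ and let $(x_k)_{k\ge0}$ be generated by $x_0=x$ and $x_{k+1}=\alpha_k x+(1-\alpha_k)Tx_k$ for $k\ge0$. Suppose there are constants $\gamma\in(0,1]$ and $c\ge1$ such that the Hölder error bound $$\mathfrak d(z)\le c\,\delta(z)^{\gamma}$$ holds for all $z$ in a compact set containing all the iterates $x_k$. Then $$\limsup_{k\to\infty}\ \frac{\mathfrak d(x_k)}{\alpha_k^{\gamma/(2-\gamma)}}\le\left(\frac{2c^{2/\gamma}\,\mathfrak d(x)}{c_0}\right)^{\gamma/(2-\gamma)} .$$ In particular, $\mathfrak d(x_k)=\mathcal O\left(\alpha_k^{\gamma/(2-\gamma)}\right)$.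
   Context: $\mathbb{R}^n$ is Euclidean space with norm $\|\cdot\|$. $\mathfrak d(z):=\mathrm{dist}(z,S)$ and $\delta(z):=\max_{1\le i\le m}\mathrm{dist}(z,U_i)$. *)

theory Defs
  imports "HOL-Analysis.Analysis" "HOL-Library.Landau_Symbols"
begin

definition intersection_set :: "nat \<Rightarrow> (nat \<Rightarrow> (real ^ 'n) set) \<Rightarrow> (real ^ 'n) set"
  where "intersection_set m U = (\<Inter>i\<in>{1..m}. U i)"

(* Meaningful only for m >= 1: the maximum of an empty set is unspecified. *)
definition max_dist :: "nat \<Rightarrow> (nat \<Rightarrow> (real ^ 'n) set) \<Rightarrow> real ^ 'n \<Rightarrow> real"
  where "max_dist m U z = Max ((\<lambda>i. infdist z (U i)) ` {1..m})"

(* infdist is the distance to a nonempty set; for the empty set it is 0. *)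
definition dist_to_intersection :: "nat \<Rightarrow> (nat \<Rightarrow> (real ^ 'n) set) \<Rightarrow> real ^ 'n \<Rightarrow> real"
  where "dist_to_intersection m U z = infdist z (intersection_set m U)"

end

theory Submission
  imports Defs
begin

text \<open>
  Write \<open>d\<close> for the distance to the intersection \<open>S\<close>. Applying the hypothesis on \<open>T\<close> at the
  point of \<open>S\<close> nearest to \<open>X k\<close> and inserting the error bound gives
  \<open>d(T(X k))\<^sup>2 \<le> d(X k)\<^sup>2 - 2\<mu> d(X k)\<^sup>2\<^sup>/\<^sup>\<gamma>\<close> with \<open>2\<mu> = c\<^sub>0 / c\<^sup>2\<^sup>/\<^sup>\<gamma>\<close>. Taking square roots costs
  half of the constant and one power of \<open>d\<close>, which leaves the exponent \<open>s = 2/\<gamma> - 1 \<ge> 1\<close>. As the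
  distance to a convex set is a convex function, the numbers \<open>d\<^sub>k = d(X k)\<close> satisfy a scalar
  recursion in which \<open>D = d(x)\<close> enters as a forcing term:
  \<open>d\<^sub>k\<^sub>+\<^sub>1 \<le> \<alpha>\<^sub>k D + d\<^sub>k - \<mu> d\<^sub>k\<^sup>s\<close>.

  The forcing and the decrease balance when \<open>\<mu> d\<^sub>k\<^sup>s = \<alpha>\<^sub>k D\<close>, so the natural quantity is
  \<open>r\<^sub>k = d\<^sub>k / \<alpha>\<^sub>k\<^sup>p\<close> with \<open>p = 1/s = \<gamma>/(2-\<gamma>)\<close>, and the claimed bound \<open>(D/\<mu>)\<^sup>p\<close> is its equilibrium.
  Fix \<open>R\<close> strictly above the equilibrium. Replacing \<open>r\<^sup>s\<close> by its tangent at \<open>R\<close>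
  (\<open>powr_tangent_le\<close>) makes the recursion affine: the excess \<open>u = max 0 (r - R)\<close> contracts by a
  factor \<open>1 - \<theta>\<epsilon>\<close> with \<open>\<epsilon> = \<alpha>\<^sub>k\<^sup>1\<^sup>-\<^sup>p\<close>, and a further \<open>\<eta>\<epsilon>\<close> is gained because \<open>R\<close> lies above the
  equilibrium. The change of scale from \<open>\<alpha>\<^sub>k\<^sup>p\<close> to \<open>\<alpha>\<^sub>k\<^sub>+\<^sub>1\<^sup>p\<close> costs only a factor \<open>1 + L\<alpha>\<^sub>k\<close>, since the
  increments of \<open>1/\<alpha>\<close> are eventually at most a constant \<open>L\<close>, and \<open>\<alpha>\<^sub>k\<close> is negligible against
  \<open>\<epsilon>\<close> because their quotient is \<open>\<alpha>\<^sub>k\<^sup>p \<rightarrow> 0\<close>. Both gains absorb this cost with room to spare, and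
  eventually \<open>u/\<alpha>\<close> is nonincreasing (\<open>anchored_step_excess\<close>). Therefore \<open>u\<close> is bounded by a
  multiple of \<open>\<alpha>\<close> and tends to \<open>0\<close>, so that \<open>limsup r \<le> R\<close>; finally \<open>R\<close> decreases to the
  equilibrium.
\<close>

section \<open>Distance to a convex set\<close>

text \<open>
  The convex combination of the points of \<open>S\<close> nearest to \<open>x\<close> and \<open>y\<close> lies in \<open>S\<close> and competes for the
  distance of the convex combination of \<open>x\<close> and \<open>y\<close>.
\<close>

lemma convex_on_infdist:
  fixes S :: "'a::{real_normed_vector,heine_borel} set"
  assumes "closed S" "convex S" "S \<noteq> {}"
  shows "convex_on UNIV (\<lambda>x. infdist x S)"
proof (rule convex_onI)
  fix t :: real and x y :: 'a
  assume t: "0 < t" "t < 1"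
  obtain p where p: "p \<in> S" "infdist x S = dist x p"
    using infdist_attains_inf assms by metis
  obtain q where q: "q \<in> S" "infdist y S = dist y q"
    using infdist_attains_inf assms by metis
  have "(1 - t) *\<^sub>R p + t *\<^sub>R q \<in> S"
    using assms(2) p(1) q(1) t by (simp add: convex_alt)
  then have "infdist ((1 - t) *\<^sub>R x + t *\<^sub>R y) S
      \<le> dist ((1 - t) *\<^sub>R x + t *\<^sub>R y) ((1 - t) *\<^sub>R p + t *\<^sub>R q)"
    by (rule infdist_le)
  also have "\<dots> = norm ((1 - t) *\<^sub>R (x - p) + t *\<^sub>R (y - q))"
    by (simp add: dist_norm algebra_simps)
  also have "\<dots> \<le> norm ((1 - t) *\<^sub>R (x - p)) + norm (t *\<^sub>R (y - q))"
    by (rule norm_triangle_ineq)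
  also have "\<dots> = (1 - t) * infdist x S + t * infdist y S"
    using t p q by (simp add: dist_norm)
  finally show "infdist ((1 - t) *\<^sub>R x + t *\<^sub>R y) S \<le> (1 - t) * infdist x S + t * infdist y S" .
qed auto

lemma infdist_power2_decrease:
  fixes S :: "'a::{real_normed_vector,heine_borel} set"
  assumes "closed S" "S \<noteq> {}"
    and decr: "\<And>s. s \<in> S \<Longrightarrow> (norm (z - s))\<^sup>2 \<le> (norm (y - s))\<^sup>2 - e"
  shows "(infdist z S)\<^sup>2 \<le> (infdist y S)\<^sup>2 - e"
proof -
  obtain s where s: "s \<in> S" "infdist y S = dist y s"
    using infdist_attains_inf assms(1,2) by metis
  have "(infdist z S)\<^sup>2 \<le> (dist z s)\<^sup>2"
    by (intro power_mono infdist_le s infdist_nonneg)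
  also have "\<dots> \<le> (infdist y S)\<^sup>2 - e"
    using decr[OF s(1)] s(2) by (simp add: dist_norm)
  finally show ?thesis .
qed

section \<open>Inequalities for real powers\<close>

text \<open>
  The tangent at \<open>R\<close> supports the convex function \<open>r\<^sup>s\<close>. The point \<open>r = 0\<close> is separate because
  convexity of \<open>powr\<close> is stated on the open half-line.
\<close>

lemma powr_tangent_le:
  fixes r R s :: real
  assumes "1 \<le> s" "0 < R" "0 \<le> r"
  shows "R powr s + s * R powr (s - 1) * (r - R) \<le> r powr s"
proof (cases "r = 0")
  case True
  have "R powr s = R powr (s - 1) * R"
    using assms by (simp add: powr_diff)
  then show ?thesis
    using assms True by (simp add: mult_right_mono)
next
  case False
  have "r powr s - R powr s \<ge> s * R powr (s - 1) * (r - R)"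
  proof (rule convex_on_imp_above_tangent[where A = "{0<..}"])
    show "convex_on {0<..} (\<lambda>x::real. x powr s)"
      using assms by (intro powr_convex)
    show "((\<lambda>x. x powr s) has_field_derivative s * R powr (s - 1)) (at R within {0<..})"
      using assms by (auto intro!: derivative_eq_intros)
  qed (use assms False in \<open>auto simp: interior_open\<close>)
  then show ?thesis by simp
qed

text \<open>
  Completing the square: with \<open>w = \<mu> d\<^sup>s\<close> the right-hand side of the hypothesis is \<open>d\<^sup>2 - 2wd\<close>, which
  is at most \<open>(d - w)\<^sup>2\<close>; that \<open>d - w\<close> is nonnegative follows from the left-hand side being a square.
\<close>

lemma le_diff_powr_of_power2_le:
  fixes t d \<mu> s :: real
  assumes "0 \<le> d" "0 \<le> \<mu>" "t\<^sup>2 \<le> d\<^sup>2 - 2 * \<mu> * d powr (s + 1)"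
  shows "t \<le> d - \<mu> * d powr s"
proof (cases "d = 0")
  case True
  then show ?thesis using assms by simp
next
  case False
  then have d: "d > 0" using assms by simp
  define w where "w = \<mu> * d powr s"
  have w: "w \<ge> 0" using assms d by (simp add: w_def)
  have t: "t\<^sup>2 \<le> d\<^sup>2 - 2 * w * d"
    using assms d by (simp add: w_def powr_add mult_ac)
  have "2 * w * d \<le> d * d"
    using order_trans[OF zero_le_power2 t] by (simp add: power2_eq_square)
  then have "2 * w \<le> d"
    using d by simp
  then have dw: "d - w \<ge> 0" using w by simp
  have "t\<^sup>2 \<le> (d - w)\<^sup>2"
    using order_trans[OF t, of "d\<^sup>2 - 2 * w * d + w\<^sup>2"] by (simp add: power2_diff mult_ac)
  then show ?thesis
    using dw power2_le_imp_le unfolding w_def by blast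
qed

section \<open>The scalar recursion\<close>

text \<open>
  One step of the recursion, from step size \<open>a\<close> to \<open>a'\<close>. Dividing by \<open>a'\<^sup>p\<close> and using
  \<open>(a/a')\<^sup>p \<le> 1 + L a\<close> together with the tangent at \<open>R\<close> yields, for the new ratio \<open>r'\<close> and the old
  excess \<open>u\<close>, that \<open>r' \<le> (1 + L a)(R + (1 - \<theta>\<epsilon>)u - \<eta>\<epsilon>)\<close>, with
  \<open>\<epsilon> = a\<^sup>1\<^sup>-\<^sup>p\<close>, \<open>\<theta> = \<mu>sR\<^sup>s\<^sup>-\<^sup>1\<close> and \<open>\<eta> = \<mu>R\<^sup>s - D\<close>. Since \<open>a = \<epsilon>a\<^sup>p\<close>, the three smallness conditions
  read \<open>L a R \<le> \<eta>\<epsilon>\<close>, \<open>2 L a \<le> \<theta>\<epsilon>\<close> and \<open>\<theta>\<epsilon> \<le> 1\<close>. The first cancels the constant terms, and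
  the second bounds the factor of \<open>u\<close> by \<open>1 - L a\<close>, hence by \<open>a'/a\<close>.
\<close>

lemma anchored_step_excess:
  fixes a a' d d' D \<mu> s p R L :: real
  assumes a: "0 < a" "0 < a'" and L: "0 \<le> L" and ratio: "a \<le> a' * (1 + L * a)"
    and s: "1 \<le> s" and p: "p = 1 / s"
    and d: "0 \<le> d" "0 \<le> d'" and rec: "d' \<le> a * D + d - \<mu> * d powr s"
    and \<mu>: "0 < \<mu>" and R: "0 < R"
    and small1: "L * a powr p * R \<le> \<mu> * R powr s - D"
    and small2: "2 * L * a powr p \<le> \<mu> * s * R powr (s - 1)"
    and small3: "\<mu> * s * R powr (s - 1) * a powr (1 - p) \<le> 1"
  shows "max 0 (d' / a' powr p - R) / a' \<le> max 0 (d / a powr p - R) / a"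
proof -
  define r where "r = d / a powr p"
  define r' where "r' = d' / a' powr p"
  define u where "u = max 0 (r - R)"
  define e where "e = a powr (1 - p)"
  define \<theta> where "\<theta> = \<mu> * s * R powr (s - 1)"
  define \<eta> where "\<eta> = \<mu> * R powr s - D"
  have p01: "0 < p" "p \<le> 1" and ps: "p * s = 1"
    using s p by auto
  have e: "0 < e" and ae: "a = e * a powr p"
    using a by (auto simp: e_def simp flip: powr_add)
  have r0: "r \<ge> 0" and r'0: "r' \<ge> 0" using d by (auto simp: r_def r'_def)
  have dr: "d = r * a powr p" using a by (simp add: r_def)
  have ds: "d powr s = r powr s * a"
    using a r0 by (simp add: dr powr_mult powr_powr ps)
  define B where "B = e * D + r - \<mu> * e * r powr s"
  have aB: "a * D + d - \<mu> * d powr s = a powr p * B"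
    unfolding ds unfolding dr B_def by (subst (1 2) ae) (simp add: algebra_simps)
  \<comment> \<open>Nonnegativity of \<open>d'\<close> enters here: \<open>B\<close> may only be multiplied by an upper bound if \<open>B \<ge> 0\<close>.\<close>
  have B0: "0 \<le> B"
  proof -
    have "0 \<le> a powr p * B" using rec d aB by simp
    then show ?thesis using a by (simp add: zero_le_mult_iff)
  qed
  have q: "(a / a') powr p \<le> 1 + L * a"
  proof -
    have "a / a' \<le> 1 + L * a" using a ratio by (simp add: field_simps)
    then have "(a / a') powr p \<le> (1 + L * a) powr p"
      using a p01 by (intro powr_mono2) auto
    also have "\<dots> \<le> (1 + L * a) powr 1"
      using a L p01 by (intro powr_mono) auto
    finally show ?thesis using a L by simp
  qed
  have "r' \<le> a powr p * B / a' powr p"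
    using rec aB a by (simp add: r'_def divide_right_mono)
  also have "\<dots> = (a / a') powr p * B"
    using a by (simp add: powr_divide)
  also have "\<dots> \<le> (1 + L * a) * B"
    using q B0 by (rule mult_right_mono)
  also have "B \<le> R + (1 - \<theta> * e) * u - \<eta> * e"
  proof -
    have "\<mu> * e * (R powr s + s * R powr (s - 1) * (r - R)) \<le> \<mu> * e * r powr s"
      using powr_tangent_le[OF s R r0] \<mu> e by (intro mult_left_mono) auto
    then have "B \<le> e * D + r - \<mu> * e * (R powr s + s * R powr (s - 1) * (r - R))"
      by (simp add: B_def)
    also have "\<dots> = R + (1 - \<theta> * e) * (r - R) - \<eta> * e"
      by (simp add: \<theta>_def \<eta>_def algebra_simps)
    also have "\<dots> \<le> R + (1 - \<theta> * e) * u - \<eta> * e"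
    proof -
      have "(1 - \<theta> * e) * (r - R) \<le> (1 - \<theta> * e) * u"
        using small3 by (intro mult_left_mono) (auto simp: u_def \<theta>_def e_def)
      then show ?thesis by simp
    qed
    finally show ?thesis .
  qed
  finally have "r' \<le> (1 + L * a) * (R + (1 - \<theta> * e) * u - \<eta> * e)"
    using a L by (simp add: mult_left_mono)
  then have 1: "r' - R \<le> (1 + L * a) * (1 - \<theta> * e) * u + (L * a * R - \<eta> * e) - L * a * \<eta> * e"
    by (simp add: algebra_simps)
  have \<eta>0: "0 \<le> \<eta>"
  proof -
    have "0 \<le> L * a powr p * R" using L R by simp
    then show ?thesis using small1 by (simp add: \<eta>_def)
  qed
  have la1: "L * a * R \<le> \<eta> * e"
  proof -
    have "e * (L * a powr p * R) \<le> e * \<eta>"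
      using small1 e by (intro mult_left_mono) (auto simp: \<eta>_def)
    then show ?thesis using ae by (simp add: mult_ac)
  qed
  have la2: "2 * L * a \<le> \<theta> * e"
  proof -
    have "2 * L * a = e * (2 * L * a powr p)"
      by (subst ae) simp
    also have "\<dots> \<le> e * \<theta>"
      using small2 e by (intro mult_left_mono) (auto simp: \<theta>_def)
    finally show ?thesis by (simp add: mult.commute)
  qed
  have u0: "0 \<le> u" by (simp add: u_def)
  have "(1 + L * a) * (1 - \<theta> * e) \<le> 1 - L * a"
  proof -
    have "0 \<le> L * a" using L a by simp
    moreover from this have "0 \<le> L * a * (\<theta> * e)" using la2 by simp
    ultimately show ?thesis using la2 by (simp add: algebra_simps)
  qed
  also have "\<dots> \<le> a' / a"
  proof -
    have "(1 - L * a) * (1 + L * a) \<le> 1"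
      using zero_le_power2[of "L * a"] by (simp add: algebra_simps power2_eq_square)
    then have "1 - L * a \<le> 1 / (1 + L * a)"
      using a L by (simp add: pos_le_divide_eq add_pos_nonneg)
    also have "\<dots> \<le> a' / a"
      using ratio a L by (simp add: field_simps add_pos_nonneg)
    finally show ?thesis .
  qed
  finally have "(1 + L * a) * (1 - \<theta> * e) * u \<le> a' / a * u"
    using u0 by (rule mult_right_mono)
  moreover have "0 \<le> L * a * \<eta> * e"
    using L a \<eta>0 e by simp
  ultimately have "r' - R \<le> a' / a * u" using 1 la1 by linarith
  moreover have "0 \<le> a' / a * u" using a u0 by simp
  ultimately have "max 0 (r' - R) \<le> a' / a * u" by simp
  then have "max 0 (r' - R) / a' \<le> a' / a * u / a'"
    using a by (intro divide_right_mono) auto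
  then show ?thesis using a by (simp add: u_def r_def r'_def)
qed

lemma tendsto_powr_zero:
  fixes a :: "nat \<Rightarrow> real"
  assumes "a \<longlonglongrightarrow> 0" "0 < q" "\<And>k. 0 < a k"
  shows "(\<lambda>k. a k powr q) \<longlonglongrightarrow> 0"
  using tendsto_powr'[OF assms(1) tendsto_const[of q]] assms(2,3)
  by (simp add: less_imp_le)

text \<open>
  Monotonicity of \<open>u/a\<close> gives the decay \<open>u = O(a)\<close> at once, so divergence of the sum of the
  contraction rates never has to be discussed.
\<close>

lemma anchored_recursion_excess_tendsto_0:
  fixes a d :: "nat \<Rightarrow> real" and D \<mu> s R L :: real
  assumes a_pos: "\<And>k. 0 < a k" and a_lim: "a \<longlonglongrightarrow> 0"
    and L: "0 \<le> L"
    and a_inc: "\<forall>\<^sub>F k in sequentially. 1 / a (Suc k) - 1 / a k \<le> L"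
    and s: "1 \<le> s" and \<mu>: "0 < \<mu>" "\<mu> \<le> 1"
    and d: "\<And>k. 0 \<le> d k"
    and rec: "\<And>k. d (Suc k) \<le> a k * D + d k - \<mu> * d k powr s"
    and R: "0 < R" "D < \<mu> * R powr s"
  shows "(\<lambda>k. max 0 (d k / a k powr (1 / s) - R)) \<longlonglongrightarrow> 0"
proof -
  define p where "p = 1 / s"
  have p01: "0 < p" "p \<le> 1" using s by (auto simp: p_def)
  define u where "u k = max 0 (d k / a k powr p - R)" for k
  have ap: "(\<lambda>k. a k powr p) \<longlonglongrightarrow> 0"
    using a_lim p01(1) a_pos by (rule tendsto_powr_zero)
  have "(\<lambda>k. L * a k powr p * R) \<longlonglongrightarrow> L * 0 * R"
    by (intro tendsto_intros ap)
  then have e1: "\<forall>\<^sub>F k in sequentially. L * a k powr p * R < \<mu> * R powr s - D"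
    using R(2) by (intro order_tendstoD) auto
  have "(\<lambda>k. 2 * L * a k powr p) \<longlonglongrightarrow> 2 * L * 0"
    by (intro tendsto_intros ap)
  then have e2: "\<forall>\<^sub>F k in sequentially. 2 * L * a k powr p < \<mu> * s * R powr (s - 1)"
    using R s \<mu> by (intro order_tendstoD) auto
  \<comment> \<open>For \<open>s = 1\<close> the power of \<open>a\<close> is constantly \<open>1\<close>, and this is where \<open>\<mu> \<le> 1\<close> is used.\<close>
  have e3: "\<forall>\<^sub>F k in sequentially. \<mu> * s * R powr (s - 1) * a k powr (1 - p) \<le> 1"
  proof (cases "s = 1")
    case True
    then have "p = 1" by (simp add: p_def)
    then show ?thesis using True \<mu> R(1) a_pos by simp
  next
    case False
    then have "p < 1" using s by (simp add: p_def)
    then have "(\<lambda>k. a k powr (1 - p)) \<longlonglongrightarrow> 0"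
      using a_lim a_pos by (intro tendsto_powr_zero) auto
    then have "(\<lambda>k. \<mu> * s * R powr (s - 1) * a k powr (1 - p))
        \<longlonglongrightarrow> \<mu> * s * R powr (s - 1) * 0"
      by (intro tendsto_intros)
    then have "\<forall>\<^sub>F k in sequentially. \<mu> * s * R powr (s - 1) * a k powr (1 - p) < 1"
      by (intro order_tendstoD) auto
    then show ?thesis by (rule eventually_mono) simp
  qed
  have "\<forall>\<^sub>F k in sequentially. u (Suc k) / a (Suc k) \<le> u k / a k"
    using a_inc e1 e2 e3
  proof eventually_elim
    case (elim k)
    have "a k \<le> a (Suc k) * (1 + L * a k)"
      using elim(1) a_pos[of k] a_pos[of "Suc k"] by (simp add: field_simps)
    from anchored_step_excess[OF a_pos a_pos L this s p_def d d rec \<mu>(1) R(1)] elim(2-4)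
    show ?case by (simp add: u_def)
  qed
  then obtain N where N: "\<And>k. k \<ge> N \<Longrightarrow> u (Suc k) / a (Suc k) \<le> u k / a k"
    unfolding eventually_sequentially by blast
  have bound: "u k / a k \<le> u N / a N" if "k \<ge> N" for k
    using that by (induction k rule: dec_induct) (auto intro: order_trans[OF N])
  have "(\<lambda>k. u N / a N * a k) \<longlonglongrightarrow> u N / a N * 0"
    by (intro tendsto_intros a_lim)
  then have lim: "(\<lambda>k. u N / a N * a k) \<longlonglongrightarrow> 0" by simp
  have "u \<longlonglongrightarrow> 0"
  proof (rule tendsto_sandwich[OF _ _ tendsto_const lim])
    show "\<forall>\<^sub>F k in sequentially. 0 \<le> u k" by (simp add: u_def)
    show "\<forall>\<^sub>F k in sequentially. u k \<le> u N / a N * a k"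
      using eventually_ge_at_top[of N]
    proof eventually_elim
      case (elim k)
      then show ?case using bound[of k] a_pos[of k] by (simp add: pos_divide_le_eq)
    qed
  qed
  then show ?thesis by (simp add: u_def[abs_def] p_def)
qed

lemma anchored_recursion_eventually_less:
  fixes a d :: "nat \<Rightarrow> real" and D \<mu> s y L :: real
  assumes a_pos: "\<And>k. 0 < a k" and a_lim: "a \<longlonglongrightarrow> 0"
    and L: "0 \<le> L"
    and a_inc: "\<forall>\<^sub>F k in sequentially. 1 / a (Suc k) - 1 / a k \<le> L"
    and s: "1 \<le> s" and \<mu>: "0 < \<mu>" "\<mu> \<le> 1" and D: "0 \<le> D"
    and d: "\<And>k. 0 \<le> d k"
    and rec: "\<And>k. d (Suc k) \<le> a k * D + d k - \<mu> * d k powr s"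
    and y: "(D / \<mu>) powr (1 / s) < y"
  shows "\<forall>\<^sub>F k in sequentially. d k / a k powr (1 / s) < y"
proof -
  \<comment> \<open>Any threshold strictly between the equilibrium and \<open>y\<close> works; it is positive even if \<open>D = 0\<close>.\<close>
  define R where "R = ((D / \<mu>) powr (1 / s) + y) / 2"
  have R: "(D / \<mu>) powr (1 / s) < R" "R < y" using y by (auto simp: R_def)
  have "(D / \<mu>) powr (1 / s) \<ge> 0" by simp
  with R(1) have R0: "0 < R" by linarith
  have "((D / \<mu>) powr (1 / s)) powr s < R powr s"
    using R(1) s by (intro powr_less_mono2) auto
  then have "D / \<mu> < R powr s" using s D \<mu> by (simp add: powr_powr)
  then have "D < \<mu> * R powr s" using \<mu> by (simp add: pos_divide_less_eq mult.commute)
  from anchored_recursion_excess_tendsto_0[OF a_pos a_lim L a_inc s \<mu> d rec R0 this]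
  have "\<forall>\<^sub>F k in sequentially. max 0 (d k / a k powr (1 / s) - R) < y - R"
    using R(2) by (intro order_tendstoD) auto
  then show ?thesis by (rule eventually_mono) simp
qed

section \<open>The convergence rate\<close>

theorem theorem3p4:
  fixes m :: nat
    and U :: "nat \<Rightarrow> (real ^ 'n) set"
    and T :: "real ^ 'n \<Rightarrow> real ^ 'n"
    and \<alpha> :: "nat \<Rightarrow> real"
    and x :: "real ^ 'n"
    and X :: "nat \<Rightarrow> real ^ 'n"
    and K :: "(real ^ 'n) set"
    and c\<^sub>0 \<gamma> c :: real
  assumes m: "m \<ge> 1"
    and U: "\<And>i. i \<in> {1..m} \<Longrightarrow> closed (U i) \<and> convex (U i)"
    and nonempty: "intersection_set m U \<noteq> {}"
    and c0: "0 < c\<^sub>0" "c\<^sub>0 \<le> 1"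
    and T: "\<And>s y. s \<in> intersection_set m U \<Longrightarrow>
              (norm (T y - s))\<^sup>2 \<le> (norm (y - s))\<^sup>2 - c\<^sub>0 * (max_dist m U y)\<^sup>2"
    and alpha0: "0 < \<alpha> 0" "\<alpha> 0 \<le> 1"
    and alpha_range: "\<And>k. k \<ge> 1 \<Longrightarrow> 0 < \<alpha> k \<and> \<alpha> k \<le> 1"
    and alpha_lim: "\<alpha> \<longlonglongrightarrow> 0"
    and alpha_limsup: "limsup (\<lambda>k. ereal (1 / \<alpha> (Suc k) - 1 / \<alpha> k)) < 2"
    and alpha_ratio: "(\<lambda>k. \<alpha> k / \<alpha> (Suc k)) \<longlonglongrightarrow> 1"
    and X_0: "X 0 = x"
    and X_Suc: "\<And>k. X (Suc k) = \<alpha> k *\<^sub>R x + (1 - \<alpha> k) *\<^sub>R T (X k)"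
    and gamma: "0 < \<gamma>" "\<gamma> \<le> 1"
    and c: "c \<ge> 1"
    and K: "compact K" "\<And>k. X k \<in> K"
    and error_bound: "\<And>z. z \<in> K \<Longrightarrow>
              dist_to_intersection m U z \<le> c * max_dist m U z powr \<gamma>"
  shows "limsup (\<lambda>k. ereal (dist_to_intersection m U (X k) / \<alpha> k powr (\<gamma> / (2 - \<gamma>))))
           \<le> ereal ((2 * c powr (2 / \<gamma>) * dist_to_intersection m U x / c\<^sub>0) powr (\<gamma> / (2 - \<gamma>)))
         \<and> (\<lambda>k. dist_to_intersection m U (X k)) \<in> O(\<lambda>k. \<alpha> k powr (\<gamma> / (2 - \<gamma>)))"
proof -
  define S where "S = intersection_set m U"
  define d where "d z = infdist z S" for z
  define s where "s = 2 / \<gamma> - 1"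
  define \<mu> where "\<mu> = c\<^sub>0 / (2 * c powr (2 / \<gamma>))"
  have dist_eq: "dist_to_intersection m U z = d z" for z
    by (simp add: dist_to_intersection_def d_def S_def)
  have S: "closed S" "convex S" "S \<noteq> {}"
    using U nonempty by (auto simp: S_def intersection_set_def intro!: convex_INT)
  have s: "1 \<le> s" and s_inv: "\<gamma> / (2 - \<gamma>) = 1 / s"
    using gamma by (auto simp: s_def field_simps)
  have C: "1 \<le> c powr (2 / \<gamma>)"
    using c gamma by (simp add: ge_one_powr_ge_zero)
  have \<mu>: "0 < \<mu>" "\<mu> \<le> 1"
  proof -
    have "0 < 2 * c powr (2 / \<gamma>)" using C by linarith
    moreover have "c\<^sub>0 \<le> 2 * c powr (2 / \<gamma>)" using C c0 by linarith
    ultimately show "0 < \<mu>" "\<mu> \<le> 1"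
      using c0 by (auto simp: \<mu>_def)
  qed
  have d0: "0 \<le> d z" for z by (simp add: d_def infdist_nonneg)
  have \<alpha>: "0 < \<alpha> k" "\<alpha> k \<le> 1" for k
    using alpha0 alpha_range[of k] by (cases k; force)+
  have rec: "d (X (Suc k)) \<le> \<alpha> k * d x + d (X k) - \<mu> * d (X k) powr s" for k
  proof -
    have \<delta>0: "0 \<le> max_dist m U (X k)"
    proof -
      have "0 \<le> infdist (X k) (U 1)" by (rule infdist_nonneg)
      also have "\<dots> \<le> max_dist m U (X k)"
        unfolding max_dist_def using m by (intro Max_ge) auto
      finally show ?thesis .
    qed
    have "d (X k) powr (2 / \<gamma>) \<le> (c * max_dist m U (X k) powr \<gamma>) powr (2 / \<gamma>)"
      using error_bound[OF K(2)] gamma d0 by (intro powr_mono2) (auto simp: dist_eq)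
    also have "\<dots> = c powr (2 / \<gamma>) * (max_dist m U (X k))\<^sup>2"
      using c gamma \<delta>0 by (simp add: powr_mult powr_powr)
    finally have "d (X k) powr (2 / \<gamma>) / c powr (2 / \<gamma>) \<le> (max_dist m U (X k))\<^sup>2"
      using c by (auto simp: pos_divide_le_eq mult.commute)
    then have "c\<^sub>0 * (d (X k) powr (2 / \<gamma>) / c powr (2 / \<gamma>)) \<le> c\<^sub>0 * (max_dist m U (X k))\<^sup>2"
      using c0 by (intro mult_left_mono) auto
    then have err: "2 * \<mu> * d (X k) powr (s + 1) \<le> c\<^sub>0 * (max_dist m U (X k))\<^sup>2"
      by (simp add: \<mu>_def s_def)
    have "(d (T (X k)))\<^sup>2 \<le> (d (X k))\<^sup>2 - c\<^sub>0 * (max_dist m U (X k))\<^sup>2"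
      unfolding d_def using S T by (intro infdist_power2_decrease) (auto simp: S_def)
    with err have "(d (T (X k)))\<^sup>2 \<le> (d (X k))\<^sup>2 - 2 * \<mu> * d (X k) powr (s + 1)"
      by linarith
    then have T_le: "d (T (X k)) \<le> d (X k) - \<mu> * d (X k) powr s"
      using d0 \<mu> by (intro le_diff_powr_of_power2_le) auto
    have "d (X (Suc k)) \<le> \<alpha> k * d x + (1 - \<alpha> k) * d (T (X k))"
      unfolding d_def X_Suc
      using convex_on_infdist[OF S] \<alpha>[of k] by (auto simp: convex_on_def)
    also have "\<dots> \<le> \<alpha> k * d x + 1 * d (T (X k))"
      using \<alpha>[of k] d0 by (intro add_left_mono mult_right_mono) auto
    finally show ?thesis using T_le by linarith
  qed
  have "\<forall>\<^sub>F k in sequentially. ereal (1 / \<alpha> (Suc k) - 1 / \<alpha> k) < 2"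
    using alpha_limsup by (rule Limsup_lessD)
  then have inc: "\<forall>\<^sub>F k in sequentially. 1 / \<alpha> (Suc k) - 1 / \<alpha> k \<le> 2"
    by (rule eventually_mono) simp
  have D\<mu>: "2 * c powr (2 / \<gamma>) * d x / c\<^sub>0 = d x / \<mu>"
    using C c0 by (simp add: \<mu>_def)
  have less: "\<forall>\<^sub>F k in sequentially. d (X k) / \<alpha> k powr (1 / s) < y"
    if "(d x / \<mu>) powr (1 / s) < y" for y
    using \<alpha>(1) alpha_lim _ inc s \<mu> d0 d0 rec that
    by (rule anchored_recursion_eventually_less) simp
  show ?thesis
    unfolding dist_eq s_inv D\<mu>
  proof
    show "limsup (\<lambda>k. ereal (d (X k) / \<alpha> k powr (1 / s))) \<le> ereal ((d x / \<mu>) powr (1 / s))"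
      unfolding Limsup_le_iff
    proof (intro allI impI)
      fix y assume y: "ereal ((d x / \<mu>) powr (1 / s)) < y"
      then show "\<forall>\<^sub>F k in sequentially. ereal (d (X k) / \<alpha> k powr (1 / s)) < y"
        using less by (cases y) auto
    qed
    show "(\<lambda>k. d (X k)) \<in> O(\<lambda>k. \<alpha> k powr (1 / s))"
    proof (rule bigoI)
      have "\<forall>\<^sub>F k in sequentially. d (X k) / \<alpha> k powr (1 / s) < (d x / \<mu>) powr (1 / s) + 1"
        by (rule less) simp
      then show "\<forall>\<^sub>F k in sequentially.
          norm (d (X k)) \<le> ((d x / \<mu>) powr (1 / s) + 1) * norm (\<alpha> k powr (1 / s))"
      proof eventually_elim
        case (elim k)
        then show ?case using d0 \<alpha>(1)[of k] by (simp add: pos_divide_less_eq)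
      qed
    qed
  qed
qed

end
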